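(* Let $\alpha\in[1,\infty)$. Then the following hold: 1. The discrepancy with respect to the norm $\|\cdot\|_{\psi_\alpha}$ is polynomially tractable. 2. Let $\varphi:[0,\infty)\to(0,\infty)$ be any non-decreasing function with $\lim_{x\to\infty}\varphi(x)=\infty$ for which there exist an $r\ge 0$ and a constant $C\in(0,\infty)$ such that $\varphi(p)\le C\,p^r$ for all $p\ge 1$. Then the discrepancy with respect to $\|\cdot\|_{\psi_{\alpha,\varphi}}$ is polynomially tractable, and the $d$-exponent of polynomial tractability is at most $3+2r$. 3. Let $\varphi:[0,\infty)\to(0,\infty)$ be any non-decreasing function with $\lim_{x\to\infty}\varphi(x)=\infty$ which satisfies $\lim_{p\to\infty}\frac{\log\varphi(p)}{p}=0$. Then the discrepancy with respect to $\|\cdot\|_{\psi_{\alpha,\varphi}}$ is weakly tractable.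
   Context: Throughout, $\log$ is the natural logarithm and $\mathrm{Vol}$ is $d$-dimensional Lebesgue measure. Local discrepancy. For an $N$-element point set $\mathcal{P}=\{\boldsymbol{x}_1,\ldots,\boldsymbol{x}_N\}\subseteq[0,1]^d$, the local discrepancy function $\Delta_{\mathcal{P}}:[0,1]^d\to\mathbb{R}$ is $$\Delta_{\mathcal{P}}(\boldsymbol{t})=\frac{\#\{j\in\{1,\ldots,N\}:\boldsymbol{x}_j\in[\boldsymbol{0},\boldsymbol{t})\}}{N}-\mathrm{Vol}([\boldsymbol{0},\boldsymbol{t}]),$$ where $[\boldsymbol{0},\boldsymbol{t})=[0,t_1)\times\cdots\times[0,t_d)$ for $\boldsymbol{t}=(t_1,\ldots,t_d)$. For the empty point set, $\Delta_\emptyset(\boldsymbol{t})=-\mathrm{Vol}([\boldsymbol{0},\boldsymbol{t}])=-t_1\cdots t_d$. Minimal discrepancy and its inverse. Given a norm $\|\cdot\|_\bullet$ (defined for functions on $[0,1]^d$ for every $d\in\mathbb{N}$), set $$\mathrm{disc}_\bullet(N,d)=\inf_{\mathcal{P}\subseteq[0,1]^d,\ |\mathcal{P}|=N}\|\Delta_{\mathcal{P}}\|_\bullet,$$ and, for $\varepsilon\in(0,1)$ and $d\in\mathbb{N}$, $$N_\bullet(\varepsilon,d)=\min\{N\in\mathbb{N}:\mathrm{disc}_\bullet(N,d)\le\varepsilon\,\|\Delta_\emptyset\|_\bullet\}.$$ Tractability. The discrepancy with respect to $\|\cdot\|_\bullet$ is polynomially tractable if there are numbers $C,\tau,\sigma\in(0,\infty)$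 such that $N_\bullet(\varepsilon,d)\le C\,d^\tau\varepsilon^{-\sigma}$ for all $\varepsilon\in(0,1)$ and all $d\in\mathbb{N}$. The infimum over all exponents $\tau\in(0,\infty)$ for which a bound of this form holds (for some $C,\sigma\in(0,\infty)$) is called the $d$-exponent of polynomial tractability. The discrepancy with respect to $\|\cdot\|_\bullet$ is weakly tractable if $$\lim_{d+\varepsilon^{-1}\to\infty}\frac{\log N_\bullet(\varepsilon,d)}{d+\varepsilon^{-1}}=0.$$ Orlicz norms. For $\alpha\in[1,\infty)$ let $\psi_\alpha(x)=\exp(x^\alpha)-1$ for $x\ge0$, and for measurable $f$ on $[0,1]^d$ let $$\|f\|_{\psi_\alpha}=\inf\left\{K>0:\int_{[0,1]^d}\psi_\alpha\left(\frac{|f(\boldsymbol{x})|}{K}\right)\mathrm{d}\boldsymbol{x}\le1\right\}.$$ For a non-decreasing $\varphi:[0,\infty)\to(0,\infty)$ with $\lim_{x\to\infty}\varphi(x)=\infty$ let $$\psi_{\alpha,\varphi}(x)=\sum_{k=1}^\infty\frac{x^{k\alpha}}{(\varphi(k\alpha))^{k\alpha}},\qquad x\ge0$$ (the series converges for all $x\ge 0$), and $$\|f\|_{\psi_{\alpha,\varphi}}=\inf\left\{K>0:\int_{[0,1]^d}\psi_{\alpha,\varphi}\left(\frac{|f(\boldsymbol{x})|}{K}\right)\mathrm{d}\boldsymbol{x}\le1\right\}.$$ *)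

theory Defs
  imports "HOL-Analysis.Analysis"
begin

text \<open>
  The dimension \<open>d\<close> varies inside the statements, so points of \<open>\<real>\<^sup>d\<close> are extensional functions on
  the index set \<open>{..<d}\<close>, and Lebesgue measure is the product measure of \<open>d\<close> copies of \<^const>\<open>lborel\<close>.
\<close>

definition lebesgue_dim :: "nat \<Rightarrow> (nat \<Rightarrow> real) measure" where
  "lebesgue_dim d = Pi\<^sub>M {..<d} (\<lambda>_. lborel)"

definition unit_cube :: "nat \<Rightarrow> (nat \<Rightarrow> real) set" where
  "unit_cube d = PiE {..<d} (\<lambda>_. {0..1})"

definition half_open_box :: "nat \<Rightarrow> (nat \<Rightarrow> real) \<Rightarrow> (nat \<Rightarrow> real) set" where
  "half_open_box d t = PiE {..<d} (\<lambda>i. {0..<t i})"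

definition closed_box :: "nat \<Rightarrow> (nat \<Rightarrow> real) \<Rightarrow> (nat \<Rightarrow> real) set" where
  "closed_box d t = PiE {..<d} (\<lambda>i. {0..t i})"

text \<open>For the empty point set the counting term is \<open>0 / 0 = 0\<close>, which leaves minus the volume.\<close>

definition local_discrepancy :: "nat \<Rightarrow> (nat \<Rightarrow> real) set \<Rightarrow> (nat \<Rightarrow> real) \<Rightarrow> real" where
  "local_discrepancy d P t =
     real (card {x \<in> P. x \<in> half_open_box d t}) / real (card P)
       - measure (lebesgue_dim d) (closed_box d t)"

text \<open>
  A norm given in every dimension is a function \<open>nrm\<close> taking the dimension and a function on the
  cube.  Its values are in \<^typ>\<open>ennreal\<close>, so that an infimum over the empty set is infinite.
\<close>

definition min_discrepancy ::
  "(nat \<Rightarrow> ((nat \<Rightarrow> real) \<Rightarrow> real) \<Rightarrow> ennreal) \<Rightarrow> nat \<Rightarrow> nat \<Rightarrow> ennreal" where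
  "min_discrepancy nrm N d =
     (INF P \<in> {P. P \<subseteq> unit_cube d \<and> finite P \<and> card P = N}. nrm d (local_discrepancy d P))"

text \<open>
  The minimum is taken in \<^typ>\<open>enat\<close>: it is attained if some \<open>N\<close> is admissible, and infinite otherwise.
\<close>

definition inverse_discrepancy ::
  "(nat \<Rightarrow> ((nat \<Rightarrow> real) \<Rightarrow> real) \<Rightarrow> ennreal) \<Rightarrow> real \<Rightarrow> nat \<Rightarrow> enat" where
  "inverse_discrepancy nrm \<epsilon> d =
     (INF N \<in> {N. 1 \<le> N \<and> min_discrepancy nrm N d \<le> ennreal \<epsilon> * nrm d (local_discrepancy d {})}. enat N)"

definition polynomial_bound ::
  "(nat \<Rightarrow> ((nat \<Rightarrow> real) \<Rightarrow> real) \<Rightarrow> ennreal) \<Rightarrow> real \<Rightarrow> real \<Rightarrow> real \<Rightarrow> bool" where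
  "polynomial_bound nrm C \<tau> \<sigma> \<longleftrightarrow>
     (\<forall>\<epsilon>\<in>{0<..<1}. \<forall>d\<ge>1.
        ereal_of_enat (inverse_discrepancy nrm \<epsilon> d) \<le> ereal (C * real d powr \<tau> * \<epsilon> powr (- \<sigma>)))"

definition polynomially_tractable ::
  "(nat \<Rightarrow> ((nat \<Rightarrow> real) \<Rightarrow> real) \<Rightarrow> ennreal) \<Rightarrow> bool" where
  "polynomially_tractable nrm \<longleftrightarrow>
     (\<exists>C>0. \<exists>\<tau>>0. \<exists>\<sigma>>0. polynomial_bound nrm C \<tau> \<sigma>)"

text \<open>Only meaningful for polynomially tractable norms; otherwise the set of exponents is empty.\<close>

definition d_exponent :: "(nat \<Rightarrow> ((nat \<Rightarrow> real) \<Rightarrow> real) \<Rightarrow> ennreal) \<Rightarrow> real" where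
  "d_exponent nrm = Inf {\<tau>. 0 < \<tau> \<and> (\<exists>C>0. \<exists>\<sigma>>0. polynomial_bound nrm C \<tau> \<sigma>)}"

text \<open>
  The limit is along all pairs \<open>(\<epsilon>, d)\<close> with \<open>\<epsilon> \<in> (0,1)\<close> and \<open>d \<ge> 1\<close> for which \<open>d + 1/\<epsilon>\<close> tends to
  infinity.  Finiteness is required separately because \<^const>\<open>the_enat\<close> is unspecified at infinity.
\<close>

definition weakly_tractable ::
  "(nat \<Rightarrow> ((nat \<Rightarrow> real) \<Rightarrow> real) \<Rightarrow> ennreal) \<Rightarrow> bool" where
  "weakly_tractable nrm \<longleftrightarrow>
     (\<forall>\<epsilon>\<in>{0<..<1}. \<forall>d\<ge>1. inverse_discrepancy nrm \<epsilon> d < \<infinity>) \<and>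
     ((\<lambda>(\<epsilon>, d). ln (real (the_enat (inverse_discrepancy nrm \<epsilon> d))) / (real d + 1 / \<epsilon>)) \<longlongrightarrow> 0)
       (inf (filtercomap (\<lambda>(\<epsilon>, d). real d + 1 / \<epsilon>) at_top)
            (principal ({0<..<1} \<times> {1..})))"

definition orlicz_norm ::
  "(real \<Rightarrow> real) \<Rightarrow> nat \<Rightarrow> ((nat \<Rightarrow> real) \<Rightarrow> real) \<Rightarrow> ennreal" where
  "orlicz_norm \<psi> d f =
     (INF K \<in> {K. 0 < K \<and> (\<integral>\<^sup>+x\<in>unit_cube d. ennreal (\<psi> (\<bar>f x\<bar> / K)) \<partial>lebesgue_dim d) \<le> 1}. ennreal K)"

definition psi_exp :: "real \<Rightarrow> real \<Rightarrow> real" where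
  "psi_exp \<alpha> x = exp (x powr \<alpha>) - 1"

text \<open>The summation index is shifted: \<open>k = Suc j\<close> runs through the positive integers.\<close>

definition psi_growth :: "real \<Rightarrow> (real \<Rightarrow> real) \<Rightarrow> real \<Rightarrow> real" where
  "psi_growth \<alpha> \<phi> x =
     (\<Sum>j. x powr (real (Suc j) * \<alpha>) / \<phi> (real (Suc j) * \<alpha>) powr (real (Suc j) * \<alpha>))"

end

theory Submission
  imports Defs "HOL-Probability.Hoeffding"
begin

text \<open>
  Both ingredients of tractability are crude here, because powers of a logarithm do not matter.

  \<^emph>\<open>The minimal discrepancy is small in the supremum norm.\<close>  Cover the cube by a grid of mesh
  about \<open>\<delta>/d\<close>.  It has \<open>exp(O(d log(d/\<delta>)))\<close> points, so by Hoeffding's bound and a union bound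
  \<open>N \<approx> d log(d/\<delta>)/\<delta>\<^sup>2\<close> random points have local discrepancy at most \<open>\<delta>\<close> at every grid point; a box
  lies between two grid boxes whose volumes differ by at most \<open>\<delta>\<close>, so the discrepancy is at most \<open>2\<delta>\<close>
  everywhere (\<open>exists_low_discrepancy_set\<close>).  The points are chosen one at a time, by the method of
  conditional expectations: each new point keeps an exponential potential below its mean, and since
  finite sets are null it can be taken different from its predecessors.  Thus a single integral over
  the cube is needed, and the points are distinct.  Functions bounded by \<open>D\<close> have Orlicz norm at
  most \<open>D/\<kappa>\<close> as soon as \<open>\<psi>(\<kappa>) \<le> 1\<close>.

  \<^emph>\<open>The initial discrepancy is not small.\<close>  On the subcube \<open>[1 - 1/(2d), 1]\<^sup>d\<close>, of volume
  \<open>(2d)\<^sup>-\<^sup>d\<close>, the product \<open>t\<^sub>1 \<cdots> t\<^sub>d\<close> is at least \<open>1/2\<close>.  Hence every admissible \<open>K\<close> satisfies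
  \<open>\<psi>(1/(2K)) \<le> (2d)\<^sup>d\<close> (\<open>orlicz_norm_initial_discrepancy_ge\<close>).  For \<open>\<psi>\<^sub>\<alpha>\<close> taking logarithms gives
  \<open>K \<ge> 1/(8d\<^sup>2)\<close>.  For \<open>\<psi>\<^sub>\<alpha>\<^sub>,\<^sub>\<phi>\<close> the single term \<open>k = d\<close> of the series, whose exponent \<open>d\<alpha>\<close>
  matches the volume \<open>(2d)\<^sup>-\<^sup>d\<close>, gives \<open>K \<ge> 1/(4d \<phi>(d\<alpha>))\<close>, which is at least of order \<open>d\<^sup>-\<^sup>1\<^sup>-\<^sup>r\<close> if
  \<open>\<phi>(p) \<le> C p\<^sup>r\<close>.

  If the initial discrepancy is at least \<open>L\<close>, then \<open>\<delta> = \<kappa>\<epsilon>L/2\<close> is sufficient, and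
  \<open>N \<approx> d log(d/\<delta>)/\<delta>\<^sup>2\<close>.  With \<open>L \<approx> d\<^sup>-\<^sup>s\<close> this is \<open>d\<^sup>1\<^sup>+\<^sup>2\<^sup>s \<epsilon>\<^sup>-\<^sup>2\<close> up to a logarithm, which an
  infimum of exponents does not see; \<open>s = 1 + r\<close> yields \<open>3 + 2r\<close>.  For weak tractability,
  \<open>log N\<close> is bounded by multiples of \<open>log d\<close>, \<open>log(1/\<epsilon>)\<close> and \<open>log(1/L)\<close>, and the last is \<open>o(d)\<close>
  if \<open>log \<phi>(p) = o(p)\<close>.
\<close>

section \<open>Derandomised concentration for finitely many events\<close>

text \<open>
  Hoeffding's lemma for an event, with \<open>h\<close> of either sign because deviations in both directions are
  to be controlled.
\<close>

lemma (in prob_space) exp_centred_indicator: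
  assumes B: "B \<in> events"
  shows "integrable M (\<lambda>x. exp (h * (indicator B x - prob B)))"
    and "expectation (\<lambda>x. exp (h * (indicator B x - prob B))) \<le> exp (h\<^sup>2 / 8)"
proof -
  define p where "p = prob B"
  have p: "0 \<le> p" "p \<le> 1" by (auto simp: p_def)
  have eq: "(\<lambda>x. exp (h * (indicator B x - p)))
      = (\<lambda>x. indicator B x * (exp (h * (1 - p)) - exp (- h * p)) + exp (- h * p))"
    by (auto simp: fun_eq_iff indicator_def)
  have int: "integrable M (\<lambda>x. indicator B x * (exp (h * (1 - p)) - exp (- h * p)) + exp (- h * p))"
    using B by (intro Bochner_Integration.integrable_add integrable_mult_left) (auto simp: emeasure_eq_measure)
  show "integrable M (\<lambda>x. exp (h * (indicator B x - prob B)))"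
    using int by (simp only: eq flip: p_def)
  have "expectation (\<lambda>x. exp (h * (indicator B x - p)))
      = p * (exp (h * (1 - p)) - exp (- h * p)) + exp (- h * p)"
    unfolding eq using B
    by (subst Bochner_Integration.integral_add)
       (auto simp: emeasure_eq_measure p_def prob_space intro!: integrable_mult_left)
  also have "\<dots> \<le> exp (h\<^sup>2 / 8)"
  proof -
    have aux: "exp (- k * q) * (1 + q * (exp k - 1)) \<le> exp (k\<^sup>2 / 8)"
      if "k \<ge> 0" "q \<ge> 0" for k q :: real
    proof -
      have pos: "1 + q * (exp k - 1) > 0" using that by (intro add_pos_nonneg mult_nonneg_nonneg) auto
      have "exp (- k * q) * (1 + q * (exp k - 1)) = exp (- k * q + ln (1 + q * (exp k - 1)))"
        unfolding exp_add using pos by simp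
      also have "\<dots> \<le> exp (k\<^sup>2 / 8)"
        using Hoeffdings_lemma_aux[OF that] by simp
      finally show ?thesis .
    qed
    show ?thesis
    proof (cases "h \<ge> 0")
      case True
      have "exp (h * (1 - p)) = exp (- h * p) * exp h"
        by (simp add: algebra_simps flip: exp_add)
      with aux[OF True p(1)] show ?thesis by (simp add: algebra_simps)
    next
      case False
      (* exchanging the event with its complement changes the sign of h *)
      have "exp (- h * p) = exp (h * (1 - p)) * exp (- h)"
        by (simp add: algebra_simps flip: exp_add)
      with aux[of "- h" "1 - p"] False p show ?thesis by (simp add: algebra_simps)
    qed
  qed
  finally show "expectation (\<lambda>x. exp (h * (indicator B x - prob B))) \<le> exp (h\<^sup>2 / 8)"
    by (simp add: p_def)
qed

text \<open>
  The expected value of the potential for \<open>N\<close> independent random points is at most the right-hand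
  side.  Instead of arguing about \<open>N\<close> points at once, one point is added at a time: averaging over
  the new point \<open>x\<close> multiplies each summand by at most \<open>exp (h\<^sup>2 / 8)\<close>, so some \<open>x\<close> does no worse
  than average, even if a null set of points is forbidden.
\<close>

lemma (in prob_space) exists_finite_set_exp_potential_le:
  assumes null: "\<And>x. x \<in> space M \<Longrightarrow> {x} \<in> null_sets M"
    and B: "\<And>t. t \<in> T \<Longrightarrow> B t \<in> events"
  shows "\<exists>P\<subseteq>space M. finite P \<and> card P = N \<and>
    (\<Sum>t\<in>T. exp (h * (real (card (P \<inter> B t)) - N * prob (B t)))
           + exp (- h * (real (card (P \<inter> B t)) - N * prob (B t))))
      \<le> 2 * card T * exp (N * (h\<^sup>2 / 8))"
proof (induction N)
  case 0
  show ?case by (intro exI[of _ "{}"]) simp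
next
  case (Suc N)
  then obtain P where P: "P \<subseteq> space M" "finite P" "card P = N"
    and le: "(\<Sum>t\<in>T. exp (h * (real (card (P \<inter> B t)) - N * prob (B t)))
           + exp (- h * (real (card (P \<inter> B t)) - N * prob (B t))))
      \<le> 2 * card T * exp (N * (h\<^sup>2 / 8))" by blast
  define S where "S t = real (card (P \<inter> B t)) - N * prob (B t)" for t
  define X where "X t x = indicator (B t) x - prob (B t)" for t x
  define g where "g x = (\<Sum>t\<in>T. exp (h * S t) * exp (h * X t x) + exp (- h * S t) * exp (- h * X t x))" for x
  define c where "c = 2 * card T * exp (Suc N * (h\<^sup>2 / 8))"
  have int: "integrable M (\<lambda>x. exp (k * X t x))" if "t \<in> T" for t k
    unfolding X_def using exp_centred_indicator(1)[OF B[OF that]] .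
  have E: "expectation (\<lambda>x. exp (k * X t x)) \<le> exp (k\<^sup>2 / 8)" if "t \<in> T" for t k
    unfolding X_def using exp_centred_indicator(2)[OF B[OF that]] .
  have int_g: "integrable M g"
    unfolding g_def by (intro Bochner_Integration.integrable_sum Bochner_Integration.integrable_add
      integrable_mult_right int)
  have "expectation g = (\<Sum>t\<in>T. exp (h * S t) * expectation (\<lambda>x. exp (h * X t x))
      + exp (- h * S t) * expectation (\<lambda>x. exp (- h * X t x)))"
    unfolding g_def
    by (subst Bochner_Integration.integral_sum, intro Bochner_Integration.integrable_add integrable_mult_right int,
        assumption, assumption, intro sum.cong refl, subst Bochner_Integration.integral_add)
       (intro integrable_mult_right int, assumption | simp only: integral_mult_right_zero)+
  also have "\<dots> \<le> (\<Sum>t\<in>T. exp (h * S t) * exp (h\<^sup>2 / 8) + exp (- h * S t) * exp (h\<^sup>2 / 8))"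
  proof (rule sum_mono)
    fix t assume t: "t \<in> T"
    show "exp (h * S t) * expectation (\<lambda>x. exp (h * X t x))
      + exp (- h * S t) * expectation (\<lambda>x. exp (- h * X t x))
      \<le> exp (h * S t) * exp (h\<^sup>2 / 8) + exp (- h * S t) * exp (h\<^sup>2 / 8)"
      using E[OF t, of h] E[OF t, of "- h"] by (intro add_mono mult_left_mono) auto
  qed
  also have "\<dots> = (\<Sum>t\<in>T. exp (h * S t) + exp (- h * S t)) * exp (h\<^sup>2 / 8)"
    by (simp add: sum_distrib_right distrib_right)
  also have "\<dots> \<le> 2 * card T * exp (N * (h\<^sup>2 / 8)) * exp (h\<^sup>2 / 8)"
    using le by (intro mult_right_mono) (auto simp: S_def)
  also have "\<dots> = c"
    by (simp add: c_def algebra_simps add_divide_distrib flip: exp_add)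
  finally have Eg: "expectation g \<le> c" .
  have "\<exists>x\<in>space M. x \<notin> P \<and> g x \<le> c"
  proof (rule ccontr)
    assume "\<not> ?thesis"
    hence gt: "c < g x" if "x \<in> space M" "x \<notin> P" for x using that by force
    have "P \<in> null_sets M"
    proof -
      have "(\<Union>x\<in>P. {x}) \<in> null_sets M" using P null by (intro null_sets.finite_UN) auto
      thus ?thesis by simp
    qed
    hence "AE x in M. x \<notin> P" by (rule AE_not_in)
    hence "AE x in M. c < g x" using AE_space by eventually_elim (rule gt)
    from expectation_greater[OF int_g this] Eg show False by simp
  qed
  then obtain x where x: "x \<in> space M" "x \<notin> P" "g x \<le> c" by blast
  have card_eq: "real (card (insert x P \<inter> B t)) - Suc N * prob (B t) = S t + X t x" for t
    using P x by (cases "x \<in> B t") (auto simp: Int_insert_left S_def X_def algebra_simps)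
  show ?case
  proof (intro exI[of _ "insert x P"] conjI)
    show "(\<Sum>t\<in>T. exp (h * (real (card (insert x P \<inter> B t)) - Suc N * prob (B t)))
           + exp (- h * (real (card (insert x P \<inter> B t)) - Suc N * prob (B t))))
      \<le> 2 * card T * exp (Suc N * (h\<^sup>2 / 8))"
      using x(3) unfolding card_eq g_def c_def distrib_left exp_add .
  qed (use P x in auto)
qed

text \<open>
  A single deviation is bounded by the logarithm of the whole potential, which is the union bound
  over \<open>T\<close> in disguise.
\<close>

lemma (in prob_space) exists_finite_set_deviation_le:
  assumes null: "\<And>x. x \<in> space M \<Longrightarrow> {x} \<in> null_sets M"
    and T: "finite T" and B: "\<And>t. t \<in> T \<Longrightarrow> B t \<in> events"
    and \<delta>: "0 < \<delta>" and N: "0 < N" "ln (2 * card T) / (2 * \<delta>\<^sup>2) \<le> N"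
  shows "\<exists>P\<subseteq>space M. finite P \<and> card P = N \<and>
    (\<forall>t\<in>T. \<bar>real (card (P \<inter> B t)) / N - prob (B t)\<bar> \<le> \<delta>)"
proof -
  \<comment> \<open>This value minimises \<open>N * h\<^sup>2 / 8 - h * N * \<delta>\<close>, the exponent of the failure estimate.\<close>
  define h where "h = 4 * \<delta>"
  have h: "h > 0" using \<delta> by (simp add: h_def)
  obtain P where P: "P \<subseteq> space M" "finite P" "card P = N"
    and le: "(\<Sum>t\<in>T. exp (h * (real (card (P \<inter> B t)) - N * prob (B t)))
           + exp (- h * (real (card (P \<inter> B t)) - N * prob (B t))))
      \<le> 2 * card T * exp (N * (h\<^sup>2 / 8))" 
    using exists_finite_set_exp_potential_le[of T B N h, OF null B] by blast
  have "\<bar>real (card (P \<inter> B t)) / N - prob (B t)\<bar> \<le> \<delta>" if t: "t \<in> T" for t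
  proof -
    define S where "S = real (card (P \<inter> B t)) - N * prob (B t)"
    have cT: "card T > 0" using T t by (auto simp: card_gt_0_iff)
    have "exp (h * \<bar>S\<bar>) \<le> exp (h * S) + exp (- h * S)"
      by (cases "S \<ge> 0") auto
    also have "\<dots> \<le> 2 * card T * exp (N * (h\<^sup>2 / 8))"
      unfolding S_def by (rule order_trans[OF member_le_sum le]) (use T t in \<open>auto intro: add_nonneg_nonneg\<close>)
    finally have "h * \<bar>S\<bar> \<le> ln (2 * card T * exp (N * (h\<^sup>2 / 8)))"
      using cT by (subst ln_ge_iff) auto
    also have "\<dots> = ln (2 * card T) + N * (2 * \<delta>\<^sup>2)"
      using cT by (simp add: ln_mult h_def power_mult_distrib)
    also have "\<dots> \<le> N * (2 * \<delta>\<^sup>2) + N * (2 * \<delta>\<^sup>2)"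
      using N \<delta> by (simp add: field_simps)
    also have "\<dots> = h * (N * \<delta>)" by (simp add: h_def power2_eq_square)
    finally have "\<bar>S\<bar> \<le> N * \<delta>" using h by simp
    hence "\<bar>S / N\<bar> \<le> \<delta>" using N by (simp add: field_simps)
    also have "S / N = real (card (P \<inter> B t)) / N - prob (B t)"
      using N by (simp add: S_def diff_divide_distrib)
    finally show ?thesis .
  qed
  with P show ?thesis by blast
qed

section \<open>Point sets of low discrepancy\<close>

interpretation lborel_product: product_sigma_finite "\<lambda>_::nat. lborel :: real measure" by standard

lemma emeasure_lebesgue_dim_PiE:
  assumes "\<And>i. i < d \<Longrightarrow> A i \<in> sets borel"
  shows "PiE {..<d} A \<in> sets (lebesgue_dim d)"
    and "emeasure (lebesgue_dim d) (PiE {..<d} A) = (\<Prod>i<d. emeasure lborel (A i))"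
  using assms unfolding lebesgue_dim_def
  by (auto intro!: sets_PiM_I_finite lborel_product.emeasure_PiM)

lemma emeasure_lebesgue_dim_unit_cube:
  "unit_cube d \<in> sets (lebesgue_dim d)" "emeasure (lebesgue_dim d) (unit_cube d) = 1"
  unfolding unit_cube_def by (auto simp: emeasure_lebesgue_dim_PiE)

lemma emeasure_lebesgue_dim_box:
  assumes t: "\<And>i. i < d \<Longrightarrow> 0 \<le> t i"
  shows "half_open_box d t \<in> sets (lebesgue_dim d)"
    and "emeasure (lebesgue_dim d) (half_open_box d t) = ennreal (\<Prod>i<d. t i)"
    and "measure (lebesgue_dim d) (closed_box d t) = (\<Prod>i<d. t i)"
proof -
  have eq: "(\<Prod>i<d. ennreal (t i)) = ennreal (\<Prod>i<d. t i)"
    using t by (intro prod_ennreal) auto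
  have nonneg: "0 \<le> (\<Prod>i<d. t i)"
    using t by (intro prod_nonneg) auto
  show "half_open_box d t \<in> sets (lebesgue_dim d)"
    unfolding half_open_box_def by (rule emeasure_lebesgue_dim_PiE) simp
  have "(\<Prod>i<d. emeasure lborel {0..<t i}) = (\<Prod>i<d. ennreal (t i))"
       "(\<Prod>i<d. emeasure lborel {0..t i}) = (\<Prod>i<d. ennreal (t i))"
    using t by (auto intro!: prod.cong)
  thus "emeasure (lebesgue_dim d) (half_open_box d t) = ennreal (\<Prod>i<d. t i)"
    "measure (lebesgue_dim d) (closed_box d t) = (\<Prod>i<d. t i)"
    using t unfolding half_open_box_def closed_box_def measure_def
    by (simp_all add: emeasure_lebesgue_dim_PiE eq enn2real_ennreal[OF nonneg])
qed

lemma unit_cubeD: "t \<in> unit_cube d \<Longrightarrow> i < d \<Longrightarrow> 0 \<le> t i \<and> t i \<le> 1"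
  unfolding unit_cube_def by (drule PiE_mem[where x = i]) auto

lemma local_discrepancy_eq:
  assumes "t \<in> unit_cube d"
  shows "local_discrepancy d P t = real (card (P \<inter> half_open_box d t)) / card P - (\<Prod>i<d. t i)"
  using assms emeasure_lebesgue_dim_box(3)[of d t]
  by (simp add: local_discrepancy_def Int_def unit_cubeD)

text \<open>
  Both the number of points in a box and its volume are monotone in the corner, so the discrepancy
  at \<open>t\<close> is sandwiched between those at \<open>s\<close> and \<open>u\<close> up to the difference of the two volumes, at most
  \<open>d * \<gamma>\<close> since all coordinates lie in \<open>[0, 1]\<close>.
\<close>

lemma local_discrepancy_bracketing:
  assumes P: "finite P" "P \<noteq> {}" "P \<subseteq> unit_cube d"
    and t: "s \<in> unit_cube d" "t \<in> unit_cube d" "u \<in> unit_cube d"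
      "\<And>i. i < d \<Longrightarrow> s i \<le> t i" "\<And>i. i < d \<Longrightarrow> t i \<le> u i"  "\<And>i. i < d \<Longrightarrow> u i \<le> s i + \<gamma>"
    and le: "\<bar>local_discrepancy d P s\<bar> \<le> \<delta>" "\<bar>local_discrepancy d P u\<bar> \<le> \<delta>"
  shows "\<bar>local_discrepancy d P t\<bar> \<le> \<delta> + d * \<gamma>"
proof -
  have prod_mono': "(\<Prod>i<d. x i) \<le> (\<Prod>i<d. y i)"
    if "\<And>i. i < d \<Longrightarrow> x i \<le> y i" "x \<in> unit_cube d" for x y :: "nat \<Rightarrow> real"
    using that by (intro prod_mono) (auto dest: unit_cubeD)
  have "norm ((\<Prod>i<d. u i) - (\<Prod>i<d. s i)) \<le> (\<Sum>i<d. norm (u i - s i))"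
    using t unit_cubeD[OF t(1)] unit_cubeD[OF t(3)] by (intro norm_prod_diff) auto
  also have "\<dots> \<le> (\<Sum>i<d. \<gamma>)"
    using t(4-6) by (intro sum_mono) (smt (verit) lessThan_iff real_norm_def)
  finally have *: "(\<Prod>i<d. u i) - (\<Prod>i<d. s i) \<le> d * \<gamma>" by simp
  have mono: "real (card (P \<inter> half_open_box d x)) / card P \<le> real (card (P \<inter> half_open_box d y)) / card P"
    if "\<And>i. i < d \<Longrightarrow> x i \<le> y i" for x y
  proof -
    have "half_open_box d x \<subseteq> half_open_box d y"
      using that unfolding half_open_box_def by (intro PiE_mono) force
    thus ?thesis using P by (intro divide_right_mono) (auto intro!: card_mono)
  qed
  show ?thesis
    using mono[of s t, OF t(4)] mono[of t u, OF t(5)] prod_mono'[OF t(4,1)] prod_mono'[OF t(5,2)] * le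
    unfolding local_discrepancy_eq[OF t(1)] local_discrepancy_eq[OF t(2)] local_discrepancy_eq[OF t(3)]
    by linarith
qed

lemma prob_space_unit_cube: "prob_space (restrict_space (lebesgue_dim d) (unit_cube d))"
  by (intro prob_space_restrict_space emeasure_lebesgue_dim_unit_cube)

text \<open>
  Half of the budget \<open>2 * \<delta>\<close> is spent on the deviation at grid points, the other half on rounding
  to the grid.
\<close>

lemma exists_low_discrepancy_set:
  assumes d: "1 \<le> d" and \<delta>: "0 < \<delta>" "\<delta> \<le> 1"
    and N: "d * ln (6 * d / \<delta>) / (2 * \<delta>\<^sup>2) \<le> N"
  shows "\<exists>P\<subseteq>unit_cube d. finite P \<and> card P = N \<and>
    (\<forall>t\<in>unit_cube d. \<bar>local_discrepancy d P t\<bar> \<le> 2 * \<delta>)"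
proof -
  \<comment> \<open>Mesh \<open>1 / m \<le> \<delta> / d\<close>, so that rounding costs at most \<open>d * (1 / m) \<le> \<delta>\<close>.\<close>
  define m where "m = nat \<lceil>d / \<delta>\<rceil>"
  have d\<delta>: "1 \<le> d / \<delta>" using d \<delta> by (simp add: field_simps)
  have m: "d / \<delta> \<le> m" "m \<le> d / \<delta> + 1" "m > 0" 
    using d\<delta> unfolding m_def by linarith+
  define T where "T = PiE {..<d} (\<lambda>_. (\<lambda>j::nat. j / real m) ` {..m})"
  let ?M = "restrict_space (lebesgue_dim d) (unit_cube d)"
  interpret prob_space ?M by (rule prob_space_unit_cube)
  have T_sub: "T \<subseteq> unit_cube d"
    unfolding T_def unit_cube_def using m by (intro PiE_mono) auto
  have space: "space ?M = unit_cube d"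
    by (simp add: emeasure_lebesgue_dim_unit_cube)
  have finT: "finite T" unfolding T_def by (intro finite_PiE) auto
  have cardT: "card T \<le> (m + 1) ^ d"
  proof -
    have "card ((\<lambda>j::nat. j / real m) ` {..m}) \<le> m + 1"
      using card_image_le[of "{..m}" "\<lambda>j::nat. j / real m"] by simp
    thus ?thesis unfolding T_def by (simp add: card_PiE power_mono)
  qed
  have "T \<noteq> {}" unfolding T_def by (auto simp: PiE_eq_empty_iff)
  hence cardT0: "card T > 0" using finT by (simp add: card_gt_0_iff)
  have box: "half_open_box d t \<in> events" "prob (half_open_box d t) = (\<Prod>i<d. t i)" if "t \<in> T" for t
  proof -
    have t: "0 \<le> t i \<and> t i \<le> 1" if "i < d" for i using T_sub \<open>t \<in> T\<close> that by (auto dest: unit_cubeD)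
    have sub: "half_open_box d t \<subseteq> unit_cube d"
      unfolding half_open_box_def unit_cube_def using t by (intro PiE_mono) force
    show "half_open_box d t \<in> events"
      using sub t by (auto simp: sets_restrict_space_iff emeasure_lebesgue_dim_unit_cube emeasure_lebesgue_dim_box(1))
    show "prob (half_open_box d t) = (\<Prod>i<d. t i)"
      using sub t by (subst measure_restrict_space)
        (auto simp: emeasure_lebesgue_dim_unit_cube measure_def emeasure_lebesgue_dim_box(2)
              intro!: enn2real_ennreal prod_nonneg)
  qed
  have null: "{x} \<in> null_sets ?M" if "x \<in> space ?M" for x
  proof -
    have x: "x \<in> unit_cube d" using that space by simp
    hence "x \<in> extensional {..<d}" by (simp add: unit_cube_def PiE_def)
    from PiE_singleton[OF this] have eq: "{x} = PiE {..<d} (\<lambda>i. {x i})" by (rule sym)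
    have "{x} \<in> sets (lebesgue_dim d)" "emeasure (lebesgue_dim d) {x} = 0"
      using d unfolding eq by (auto simp: emeasure_lebesgue_dim_PiE simp del: PiE_singleton)
    hence "{x} \<in> null_sets (lebesgue_dim d)" by (intro null_setsI)
    with x show ?thesis
      by (simp add: null_sets_restrict_space emeasure_lebesgue_dim_unit_cube del: PiE_singleton)
  qed
  have "ln (2 * card T) \<le> ln ((2 * (m + 1)) ^ d)"
  proof (subst ln_le_cancel_iff)
    have "2 * card T \<le> 2 ^ d * (m + 1) ^ d"
      using cardT d by (intro mult_mono) (auto intro: self_le_power)
    also have "\<dots> = (2 * (m + 1)) ^ d" by (rule power_mult_distrib[symmetric])
    finally show "real (2 * card T) \<le> (2 * (m + 1)) ^ d" 
      by (metis of_nat_le_iff of_nat_power)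
  qed (use cardT0 in auto)
  also have "\<dots> = d * ln (2 * (m + 1))" using d by (simp add: ln_realpow)
  also have "\<dots> \<le> d * ln (6 * d / \<delta>)"
  proof (intro mult_left_mono)
    have "2 * real m + 2 \<le> 6 * (d / \<delta>)" using d\<delta> m(2) by linarith
    thus "ln (2 * (m + 1)) \<le> ln (6 * d / \<delta>)" by (simp add: add_pos_nonneg)
  qed auto
  finally have "ln (2 * card T) / (2 * \<delta>\<^sup>2) \<le> N"
    using N \<delta> by (smt (verit) divide_right_mono zero_le_power2)
  moreover have "N > 0"
  proof -
    have "ln (6 * d / \<delta>) > 0" using d\<delta> by (intro ln_gt_zero) simp
    hence "0 < d * ln (6 * d / \<delta>) / (2 * \<delta>\<^sup>2)" using d \<delta> by auto
    thus ?thesis using N by linarith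
  qed
  ultimately obtain P where P: "P \<subseteq> unit_cube d" "finite P" "card P = N"
      "\<forall>t\<in>T. \<bar>real (card (P \<inter> half_open_box d t)) / N - prob (half_open_box d t)\<bar> \<le> \<delta>"
    using exists_finite_set_deviation_le[of T "half_open_box d" \<delta> N, OF null finT box(1) \<delta>(1)]
    unfolding space by blast
  have PT: "\<bar>local_discrepancy d P t\<bar> \<le> \<delta>" if "t \<in> T" for t
  proof -
    have "t \<in> unit_cube d" using T_sub that by blast
    from local_discrepancy_eq[OF this, of P] show ?thesis
      using P(3) bspec[OF P(4) that] box(2)[OF that] by simp
  qed
  have "\<bar>local_discrepancy d P t\<bar> \<le> 2 * \<delta>" if t: "t \<in> unit_cube d" for t
  proof -
    define s where "s = (\<lambda>i\<in>{..<d}. nat \<lfloor>m * t i\<rfloor> / real m)"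
    define u where "u = (\<lambda>i\<in>{..<d}. nat \<lceil>m * t i\<rceil> / real m)"
    have mt: "0 \<le> m * t i" "m * t i \<le> m" if "i < d" for i
      using unit_cubeD[OF t that] by (auto simp: mult_left_le)
    have "nat \<lfloor>m * t i\<rfloor> \<le> m" "nat \<lceil>m * t i\<rceil> \<le> m" if "i < d" for i
      using mt[OF that] by linarith+
    hence s: "s \<in> T" and u: "u \<in> T"
      unfolding s_def u_def T_def by (auto simp: restrict_PiE_iff intro!: imageI)
    have "\<bar>local_discrepancy d P t\<bar> \<le> \<delta> + d * (1 / m)"
    proof (rule local_discrepancy_bracketing[where s = s and u = u])
      fix i assume i: "i < d"
      have "real (nat \<lfloor>m * t i\<rfloor>) \<le> m * t i" using mt(1)[OF i] by (simp add: of_nat_nat)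
      thus "s i \<le> t i" using i m(3) by (simp add: s_def field_simps)
      have "m * t i \<le> real (nat \<lceil>m * t i\<rceil>)" by (rule real_nat_ceiling_ge)
      thus "t i \<le> u i" using i m(3) by (simp add: u_def field_simps)
      have "\<lceil>m * t i\<rceil> \<le> \<lfloor>m * t i\<rfloor> + 1" using ceiling_diff_floor_le_1[of "m * t i"] by linarith
      hence "nat \<lceil>m * t i\<rceil> \<le> nat \<lfloor>m * t i\<rfloor> + 1" by linarith
      hence "real (nat \<lceil>m * t i\<rceil>) \<le> real (nat \<lfloor>m * t i\<rfloor>) + 1" by linarith
      thus "u i \<le> s i + 1 / m" using i m(3) by (simp add: s_def u_def field_simps)
    next
      show "finite P" "P \<noteq> {}" "P \<subseteq> unit_cube d" using P(1-3) \<open>N > 0\<close> by auto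
      show "s \<in> unit_cube d" "u \<in> unit_cube d" using s u T_sub by blast+
    qed (fact t PT[OF s] PT[OF u])+
    also have "d * (1 / m) \<le> \<delta>"
      using m(1,3) \<delta>(1) by (simp add: pos_divide_le_eq mult.commute)
    finally show ?thesis by simp
  qed
  with P show ?thesis by blast
qed

section \<open>Orlicz norms of local discrepancies\<close>

text \<open>
  Bernoulli's inequality; the side length \<open>1 / (2 * d)\<close> is small enough to keep the product of \<open>d\<close>
  coordinates bounded below, and its \<open>d\<close>-th power only costs the factor \<open>(2 * d) ^ d\<close> below.
\<close>

lemma abs_initial_discrepancy_ge_half:
  assumes d: "1 \<le> d" and t: "t \<in> PiE {..<d} (\<lambda>_. {1 - 1 / (2 * real d)..1})"
  shows "t \<in> unit_cube d" and "1 / 2 \<le> \<bar>local_discrepancy d {} t\<bar>"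
proof -
  have d': "0 \<le> 1 - 1 / (2 * real d)" using d by (simp add: field_simps)
  have "PiE {..<d} (\<lambda>_. {1 - 1 / (2 * real d)..1}) \<subseteq> unit_cube d"
    unfolding unit_cube_def using d' by (intro PiE_mono) auto
  with t show t': "t \<in> unit_cube d" by blast
  have ti: "1 - 1 / (2 * real d) \<le> t i" if "i < d" for i
    using PiE_mem[OF t, of i] that by simp
  have "1 / 2 = 1 + real d * (- 1 / (2 * real d))" using d by simp
  also have "\<dots> \<le> (1 + (- 1 / (2 * real d))) ^ d"
    using d' by (intro Bernoulli_inequality) simp
  also have "\<dots> = (\<Prod>i<d. 1 - 1 / (2 * real d))" by simp
  also have "\<dots> \<le> (\<Prod>i<d. t i)" using ti d' by (intro prod_mono) auto
  also have "\<dots> \<le> \<bar>local_discrepancy d {} t\<bar>"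
    using local_discrepancy_eq[OF t', of "{}"] by simp
  finally show "1 / 2 \<le> \<bar>local_discrepancy d {} t\<bar>" .
qed

text \<open>
  The constant \<open>\<kappa>\<close> converts bounds in the supremum norm into bounds in the Orlicz norm; taking it at
  most \<open>1\<close> keeps the accuracy \<open>\<kappa> * \<epsilon> * L / 2\<close> requested from the point sets below \<open>1\<close>.
\<close>

locale young_function =
  fixes \<psi> :: "real \<Rightarrow> real" and \<kappa> :: real
  assumes mono: "mono_on {0..} \<psi>"
    and \<kappa>: "0 < \<kappa>" "\<kappa> \<le> 1" "\<psi> \<kappa> \<le> 1"
begin

lemma orlicz_norm_le:
  assumes D: "0 < D" and f: "\<And>t. t \<in> unit_cube d \<Longrightarrow> \<bar>f t\<bar> \<le> D"
  shows "orlicz_norm \<psi> d f \<le> ennreal (D / \<kappa>)"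
  unfolding orlicz_norm_def
proof (rule INF_lower, intro CollectI conjI)
  show "0 < D / \<kappa>" using D \<kappa> by simp
  have "(\<integral>\<^sup>+x\<in>unit_cube d. ennreal (\<psi> (\<bar>f x\<bar> / (D / \<kappa>))) \<partial>lebesgue_dim d)
      \<le> (\<integral>\<^sup>+x. indicator (unit_cube d) x \<partial>lebesgue_dim d)"
  proof (rule nn_integral_mono)
    fix x
    have "\<psi> (\<bar>f x\<bar> / (D / \<kappa>)) \<le> 1" if "x \<in> unit_cube d"
    proof -
      have "\<bar>f x\<bar> / (D / \<kappa>) \<le> \<kappa>" using f[OF that] D \<kappa> by (simp add: field_simps)
      hence "\<psi> (\<bar>f x\<bar> / (D / \<kappa>)) \<le> \<psi> \<kappa>"
        using D \<kappa> by (intro mono_onD[OF mono]) auto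
      with \<kappa> show ?thesis by simp
    qed
    thus "ennreal (\<psi> (\<bar>f x\<bar> / (D / \<kappa>))) * indicator (unit_cube d) x \<le> indicator (unit_cube d) x"
      by (auto simp: indicator_def ennreal_le_1)
  qed
  also have "\<dots> = 1" by (simp add: emeasure_lebesgue_dim_unit_cube)
  finally show "(\<integral>\<^sup>+x\<in>unit_cube d. ennreal (\<psi> (\<bar>f x\<bar> / (D / \<kappa>))) \<partial>lebesgue_dim d) \<le> 1" .
qed

text \<open>
  If \<open>K\<close> is admissible in the Orlicz norm, restricting the integral to the subcube, where the
  discrepancy is at least \<open>1 / 2\<close>, gives \<open>\<psi> (1 / (2 * K)) \<le> (2 * d) ^ d\<close>.  So a lower bound for the
  norm amounts to an upper bound for the values \<open>x\<close> with \<open>\<psi> x \<le> (2 * d) ^ d\<close>.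
\<close>

lemma orlicz_norm_initial_discrepancy_ge:
  assumes d: "1 \<le> d" and L: "0 < L"
    and inv: "\<And>x. 0 \<le> x \<Longrightarrow> \<psi> x \<le> (2 * real d) ^ d \<Longrightarrow> x \<le> 1 / (2 * L)"
  shows "ennreal L \<le> orlicz_norm \<psi> d (local_discrepancy d {})"
  unfolding orlicz_norm_def
proof (rule INF_greatest)
  fix K
  let ?f = "local_discrepancy d {}"
  assume "K \<in> {K. 0 < K \<and> (\<integral>\<^sup>+x\<in>unit_cube d. ennreal (\<psi> (\<bar>?f x\<bar> / K)) \<partial>lebesgue_dim d) \<le> 1}"
  hence K: "0 < K" and int: "(\<integral>\<^sup>+x\<in>unit_cube d. ennreal (\<psi> (\<bar>?f x\<bar> / K)) \<partial>lebesgue_dim d) \<le> 1"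
    by auto
  define c where "c = \<psi> (1 / (2 * K))"
  define Q where "Q = PiE {..<d} (\<lambda>_. {1 - 1 / (2 * real d)..1})"
  have Q: "Q \<in> sets (lebesgue_dim d)" "emeasure (lebesgue_dim d) Q = ennreal ((1 / (2 * real d)) ^ d)"
    unfolding Q_def using d by (auto simp: emeasure_lebesgue_dim_PiE ennreal_power)
  have "ennreal (c * (1 / (2 * real d)) ^ d) = (\<integral>\<^sup>+x. ennreal c * indicator Q x \<partial>lebesgue_dim d)"
    using Q d by (subst nn_integral_cmult_indicator) (auto simp: ennreal_mult'')
  also have "\<dots> \<le> (\<integral>\<^sup>+x\<in>unit_cube d. ennreal (\<psi> (\<bar>?f x\<bar> / K)) \<partial>lebesgue_dim d)"
  proof (rule nn_integral_mono)
    fix x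
    have "x \<in> unit_cube d \<and> c \<le> \<psi> (\<bar>?f x\<bar> / K)" if "x \<in> Q"
    proof -
      note x = abs_initial_discrepancy_ge_half[OF d that[unfolded Q_def]]
      have "1 / (2 * K) \<le> \<bar>?f x\<bar> / K" using x(2) K by (simp add: field_simps)
      hence "c \<le> \<psi> (\<bar>?f x\<bar> / K)"
        unfolding c_def using K by (intro mono_onD[OF mono]) auto
      with x show ?thesis by simp
    qed
    thus "ennreal c * indicator Q x \<le> ennreal (\<psi> (\<bar>?f x\<bar> / K)) * indicator (unit_cube d) x"
      by (auto simp: indicator_def ennreal_leI)
  qed
  also note int
  finally have "c * (1 / (2 * real d)) ^ d \<le> 1" by (simp add: ennreal_le_1)
  hence "c \<le> (2 * real d) ^ d" using d by (simp add: power_one_over field_simps)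
  hence "1 / (2 * K) \<le> 1 / (2 * L)" unfolding c_def using K by (intro inv) auto
  hence "L \<le> K" using K L by (simp add: field_simps)
  thus "ennreal L \<le> ennreal K" by (rule ennreal_leI)
qed

lemma inverse_discrepancy_le:
  assumes d: "1 \<le> d" and \<epsilon>: "0 < \<epsilon>" "\<epsilon> < 1" and L: "0 < L" "L \<le> 1"
    and le: "ennreal L \<le> orlicz_norm \<psi> d (local_discrepancy d {})"
    and N: "1 \<le> N" and \<delta>: "\<delta> = \<kappa> * \<epsilon> * L / 2" and N_ge: "d * ln (6 * d / \<delta>) / (2 * \<delta>\<^sup>2) \<le> N"
  shows "inverse_discrepancy (orlicz_norm \<psi>) \<epsilon> d \<le> enat N"
  unfolding inverse_discrepancy_def
proof (rule INF_lower, intro CollectI conjI)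
  have "\<kappa> * \<epsilon> * L \<le> 1 * 1 * 1" using \<kappa> \<epsilon> L by (intro mult_mono) auto
  hence \<delta>': "0 < \<delta>" "\<delta> \<le> 1" using \<kappa> \<epsilon> L by (auto simp: \<delta>)
  obtain P where P: "P \<subseteq> unit_cube d" "finite P" "card P = N"
    "\<forall>t\<in>unit_cube d. \<bar>local_discrepancy d P t\<bar> \<le> 2 * \<delta>"
    using exists_low_discrepancy_set[OF d \<delta>' N_ge] by blast
  have "min_discrepancy (orlicz_norm \<psi>) N d \<le> orlicz_norm \<psi> d (local_discrepancy d P)"
    unfolding min_discrepancy_def using P by (intro INF_lower) auto
  also have "\<dots> \<le> ennreal (2 * \<delta> / \<kappa>)"
    using P(4) \<delta>' by (intro orlicz_norm_le) auto
  also have "2 * \<delta> / \<kappa> = \<epsilon> * L" using \<kappa> by (simp add: \<delta>)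
  also have "ennreal (\<epsilon> * L) = ennreal \<epsilon> * ennreal L" using L by (intro ennreal_mult'') simp
  also have "\<dots> \<le> ennreal \<epsilon> * orlicz_norm \<psi> d (local_discrepancy d {})"
    using le by (rule mult_left_mono) simp
  finally show "min_discrepancy (orlicz_norm \<psi>) N d
      \<le> ennreal \<epsilon> * orlicz_norm \<psi> d (local_discrepancy d {})" .
qed (fact N)

text \<open>
  The logarithm in the cardinality is traded for a small power \<open>\<eta>\<close>, which turns the bound into a
  product of powers.  Small \<open>\<eta>\<close> loses little in the exponents of \<open>d\<close> and \<open>\<epsilon>\<close>; \<open>\<eta> = 1\<close> suffices
  when only the logarithm of the bound matters.
\<close>

lemma inverse_discrepancy_le_powr:
  assumes d: "1 \<le> d" and \<epsilon>: "0 < \<epsilon>" "\<epsilon> < 1" and L: "0 < L" "L \<le> 1"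
    and le: "ennreal L \<le> orlicz_norm \<psi> d (local_discrepancy d {})"
    and \<eta>: "0 < \<eta>" "\<eta> \<le> 1"
  shows "\<exists>N\<ge>1. inverse_discrepancy (orlicz_norm \<psi>) \<epsilon> d \<le> enat N \<and>
    real N \<le> 6 / \<eta> * real d powr (1 + \<eta>) * (\<kappa> * \<epsilon> * L / 2) powr - (2 + \<eta>)"
proof -
  define \<delta> where "\<delta> = \<kappa> * \<epsilon> * L / 2"
  have "\<kappa> * \<epsilon> * L \<le> 1 * 1 * 1" using \<kappa> \<epsilon> L by (intro mult_mono) auto
  hence \<delta>: "0 < \<delta>" "\<delta> \<le> 1 / 2" using \<kappa> \<epsilon> L by (auto simp: \<delta>_def)
  define y where "y = d * ln (6 * d / \<delta>) / (2 * \<delta>\<^sup>2)"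
  define z where "z = d * ((6 * d / \<delta>) powr \<eta> / \<eta>) / (2 * \<delta>\<^sup>2)"
  define N where "N = nat \<lceil>y\<rceil>"
  have d\<delta>: "1 < 6 * d / \<delta>" using d \<delta> by (simp add: field_simps)
  have "0 < ln (6 * d / \<delta>)" using d\<delta> by (rule ln_gt_zero)
  hence y: "0 < y" using d \<delta> by (auto simp: y_def)
  hence N: "1 \<le> N" "y \<le> N" "N \<le> y + 1" unfolding N_def by linarith+
  have "ln (6 * d / \<delta>) \<le> (6 * d / \<delta>) powr \<eta> / \<eta>"
    using d\<delta> \<eta> by (intro ln_powr_bound) auto
  hence "y \<le> z" unfolding y_def z_def using \<delta> by (intro divide_right_mono mult_left_mono) auto
  moreover have "1 \<le> z"
  proof -
    have "\<delta>\<^sup>2 \<le> (1 / 2)\<^sup>2" using \<delta> by (intro power_mono) auto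
    hence "2 * \<delta>\<^sup>2 \<le> 1" by (simp add: power2_eq_square)
    moreover have "1 * 1 \<le> d * ((6 * d / \<delta>) powr \<eta> / \<eta>)"
    proof (intro mult_mono)
      have "1 \<le> (6 * d / \<delta>) powr \<eta>" using d\<delta> \<eta> by (intro ge_one_powr_ge_zero) auto
      thus "1 \<le> (6 * d / \<delta>) powr \<eta> / \<eta>" using \<eta> by (simp add: field_simps)
    qed (use d in auto)
    ultimately show ?thesis unfolding z_def using \<delta> by (subst le_divide_eq_1_pos) auto
  qed
  ultimately have "N \<le> 2 * z" using N by linarith
  also have "2 * z = 6 powr \<eta> / \<eta> * (real d * real d powr \<eta>) * (1 / (\<delta>\<^sup>2 * \<delta> powr \<eta>))"
    using \<delta> by (simp add: z_def powr_mult powr_divide field_simps)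
  also have "real d * real d powr \<eta> = real d powr (1 + \<eta>)" using d by (simp add: powr_add)
  also have "1 / (\<delta>\<^sup>2 * \<delta> powr \<eta>) = \<delta> powr - (2 + \<eta>)"
    using \<delta> by (simp only: powr_minus powr_add powr_numeral inverse_eq_divide)
  also have "6 powr \<eta> / \<eta> * real d powr (1 + \<eta>) * \<delta> powr - (2 + \<eta>)
      \<le> 6 / \<eta> * real d powr (1 + \<eta>) * \<delta> powr - (2 + \<eta>)"
    using \<eta> powr_mono[of \<eta> 1 6] by (intro mult_right_mono divide_right_mono) auto
  finally show ?thesis
    using N inverse_discrepancy_le[OF d \<epsilon> L le N(1) \<delta>_def] by (auto simp: y_def \<delta>_def)
qed

end

section \<open>Tractability from lower bounds for the initial discrepancy\<close>

context young_function
begin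

lemma polynomial_bound_if_initial_discrepancy_ge:
  assumes c: "0 < c" "c \<le> 1" and s: "0 \<le> s"
    and le: "\<And>d. 1 \<le> d \<Longrightarrow> ennreal (c * real d powr - s) \<le> orlicz_norm \<psi> d (local_discrepancy d {})"
    and \<tau>: "1 + 2 * s < \<tau>"
  shows "\<exists>C>0. \<exists>\<sigma>>0. polynomial_bound (orlicz_norm \<psi>) C \<tau> \<sigma>"
proof -
  \<comment> \<open>The largest admissible \<open>\<eta>\<close> for which the exponent of \<open>d\<close>, computed below, stays at most \<open>\<tau>\<close>.\<close>
  define \<eta> where "\<eta> = min 1 ((\<tau> - (1 + 2 * s)) / (1 + s))"
  have \<eta>: "0 < \<eta>" "\<eta> \<le> 1" using s \<tau> by (auto simp: \<eta>_def)
  have "\<eta> * (1 + s) \<le> (\<tau> - (1 + 2 * s)) / (1 + s) * (1 + s)"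
    using s by (intro mult_right_mono) (auto simp: \<eta>_def)
  also have "\<dots> = \<tau> - (1 + 2 * s)" using s by simp
  finally have exponent: "1 + \<eta> + s * (2 + \<eta>) \<le> \<tau>" by (simp add: algebra_simps)
  define C where "C = 6 / \<eta> * (\<kappa> * c / 2) powr - (2 + \<eta>)"
  have "polynomial_bound (orlicz_norm \<psi>) C \<tau> (2 + \<eta>)"
    unfolding polynomial_bound_def
  proof (intro ballI allI impI)
    fix \<epsilon> :: real and d :: nat
    assume "\<epsilon> \<in> {0<..<1}" and d: "1 \<le> d"
    hence \<epsilon>: "0 < \<epsilon>" "\<epsilon> < 1" by auto
    define L where "L = c * real d powr - s"
    have "real d powr - s \<le> 1" using powr_mono[of "- s" 0 "real d"] s d by simp
    hence L: "0 < L" "L \<le> 1" using c d mult_mono[of c 1 "real d powr - s" 1] by (auto simp: L_def)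
    obtain N where N: "inverse_discrepancy (orlicz_norm \<psi>) \<epsilon> d \<le> enat N"
      "real N \<le> 6 / \<eta> * real d powr (1 + \<eta>) * (\<kappa> * \<epsilon> * L / 2) powr - (2 + \<eta>)"
      using inverse_discrepancy_le_powr[OF d \<epsilon> L _ \<eta>] le[OF d] unfolding L_def by blast
    have "\<kappa> * \<epsilon> * L / 2 = (\<kappa> * c / 2) * (\<epsilon> * real d powr - s)" by (simp add: L_def)
    also have "\<dots> powr - (2 + \<eta>)
        = (\<kappa> * c / 2) powr - (2 + \<eta>) * (\<epsilon> powr - (2 + \<eta>) * (real d powr - s) powr - (2 + \<eta>))"
      using \<kappa> c \<epsilon> by (simp only: powr_mult)
    also have "(real d powr - s) powr - (2 + \<eta>) = real d powr (s * (2 + \<eta>))"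
      by (simp add: powr_powr algebra_simps)
    finally have "real N \<le> C * \<epsilon> powr - (2 + \<eta>) * (real d powr (1 + \<eta>) * real d powr (s * (2 + \<eta>)))"
      using N(2) by (simp add: C_def mult_ac)
    also have "real d powr (1 + \<eta>) * real d powr (s * (2 + \<eta>)) = real d powr (1 + \<eta> + s * (2 + \<eta>))"
      by (simp add: powr_add)
    also have "C * \<epsilon> powr - (2 + \<eta>) * real d powr (1 + \<eta> + s * (2 + \<eta>))
        \<le> C * \<epsilon> powr - (2 + \<eta>) * real d powr \<tau>"
      using exponent d \<eta> by (intro mult_left_mono powr_mono) (auto simp: C_def)
    also have "\<dots> = C * real d powr \<tau> * \<epsilon> powr - (2 + \<eta>)" by (simp add: mult_ac)
    finally have N_le: "ereal (real N) \<le> ereal (C * real d powr \<tau> * \<epsilon> powr - (2 + \<eta>))"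
      unfolding ereal_less_eq .
    have "ereal_of_enat (inverse_discrepancy (orlicz_norm \<psi>) \<epsilon> d) \<le> ereal_of_enat (enat N)"
      using N(1) by (simp only: ereal_of_enat_le_iff)
    also have "\<dots> = ereal (real N)" by simp
    also note N_le
    finally show "ereal_of_enat (inverse_discrepancy (orlicz_norm \<psi>) \<epsilon> d)
        \<le> ereal (C * real d powr \<tau> * \<epsilon> powr - (2 + \<eta>))" .
  qed
  moreover have "0 < C" "0 < 2 + \<eta>" using \<eta> \<kappa> c by (auto simp: C_def)
  ultimately show ?thesis by blast
qed

lemma ln_inverse_discrepancy_le:
  assumes d: "1 \<le> d" and \<epsilon>: "0 < \<epsilon>" "\<epsilon> < 1" and L: "0 < L" "L \<le> 1"
    and le: "ennreal L \<le> orlicz_norm \<psi> d (local_discrepancy d {})"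
  defines "n \<equiv> inverse_discrepancy (orlicz_norm \<psi>) \<epsilon> d"
  shows "n < \<infinity>" and "0 \<le> ln (real (the_enat n))"
    and "ln (real (the_enat n)) \<le> ln 6 + 3 * ln (2 / \<kappa>) + 2 * ln (real d) + 3 * ln (1 / \<epsilon>) + 3 * ln (1 / L)"
proof -
  obtain N where N: "n \<le> enat N" "1 \<le> N"
    "real N \<le> 6 / 1 * real d powr (1 + 1) * (\<kappa> * \<epsilon> * L / 2) powr - (2 + 1)"
    using inverse_discrepancy_le_powr[OF d \<epsilon> L le, of 1] unfolding n_def by auto
  show "n < \<infinity>" using N(1) by (cases n) auto
  then obtain k where k: "n = enat k" by (cases n) auto
  have "enat 1 \<le> n"
    unfolding n_def inverse_discrepancy_def by (intro INF_greatest) simp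
  hence k1: "1 \<le> k" and kN: "k \<le> N" using N(1) by (simp_all add: k)
  show "0 \<le> ln (real (the_enat n))" using k1 by (simp add: k)
  have "ln (real k) \<le> ln (real N)" using k1 kN by simp
  also have "\<dots> \<le> ln (6 / 1 * real d powr (1 + 1) * (\<kappa> * \<epsilon> * L / 2) powr - (2 + 1))"
    using N(2,3) by (subst ln_le_cancel_iff) auto
  also have "\<dots> = ln 6 + 2 * ln (real d) + - 3 * ln (\<kappa> * \<epsilon> * L / 2)"
    using d \<kappa> \<epsilon> L by (simp add: ln_mult ln_powr ln_realpow)
  also have "\<dots> = ln 6 + 3 * ln (2 / \<kappa>) + 2 * ln (real d) + 3 * ln (1 / \<epsilon>) + 3 * ln (1 / L)"
    using \<kappa> \<epsilon> L by (simp add: ln_mult ln_div)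
  finally show "ln (real (the_enat n))
      \<le> ln 6 + 3 * ln (2 / \<kappa>) + 2 * ln (real d) + 3 * ln (1 / \<epsilon>) + 3 * ln (1 / L)" by (simp add: k)
qed

end

text \<open>
  In the limit \<open>d + 1 / \<epsilon> \<rightarrow> \<infinity>\<close> the dimension may stay bounded, so an asymptotic statement in \<open>d\<close> is
  not enough; the constant \<open>B\<close> absorbs the small dimensions.
\<close>

lemma sublinear_imp_affine_bound:
  fixes A :: "nat \<Rightarrow> real"
  assumes lim: "(\<lambda>d. A d / real d) \<longlonglongrightarrow> 0" and \<eta>: "0 < \<eta>"
  shows "\<exists>B. \<forall>d\<ge>1. A d \<le> \<eta> * real d + B"
proof -
  from order_tendstoD(2)[OF lim \<eta>] obtain d0 where d0: "\<And>d. d \<ge> d0 \<Longrightarrow> A d / real d < \<eta>"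
    by (auto simp: eventually_sequentially)
  have "A d \<le> \<eta> * real d + (\<Sum>k<d0. \<bar>A k\<bar>)" if d: "1 \<le> d" for d
  proof (cases "d < d0")
    case True
    hence "\<bar>A d\<bar> \<le> (\<Sum>k<d0. \<bar>A k\<bar>)" by (intro member_le_sum) auto
    moreover have "0 \<le> \<eta> * real d" using \<eta> by simp
    ultimately show ?thesis by linarith
  next
    case False
    with d0[of d] d have "A d \<le> \<eta> * real d" by (simp add: field_simps)
    moreover have "0 \<le> (\<Sum>k<d0. \<bar>A k\<bar>)" by (intro sum_nonneg) auto
    ultimately show ?thesis by linarith
  qed
  thus ?thesis by blast
qed

context young_function
begin

lemma weakly_tractable_if_initial_discrepancy_ge:
  assumes L: "\<And>d. 1 \<le> d \<Longrightarrow> 0 < L d" "\<And>d. 1 \<le> d \<Longrightarrow> L d \<le> 1"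
    and le: "\<And>d. 1 \<le> d \<Longrightarrow> ennreal (L d) \<le> orlicz_norm \<psi> d (local_discrepancy d {})"
    and lim: "(\<lambda>d. ln (1 / L d) / real d) \<longlonglongrightarrow> 0"
  shows "weakly_tractable (orlicz_norm \<psi>)"
proof -
  let ?n = "\<lambda>\<epsilon> d. inverse_discrepancy (orlicz_norm \<psi>) \<epsilon> d"
  let ?g = "\<lambda>(\<epsilon>, d). ln (real (the_enat (?n \<epsilon> d))) / (real d + 1 / \<epsilon>)"
  note bound = ln_inverse_discrepancy_le[OF _ _ _ L le]
  have fin: "\<forall>\<epsilon>\<in>{0<..<1}. \<forall>d\<ge>1. ?n \<epsilon> d < \<infinity>" using bound(1) by auto
  have lnd: "(\<lambda>d. ln (real d) / real d) \<longlonglongrightarrow> 0"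
    using filterlim_compose[OF ln_x_over_x_tendsto_0 filterlim_real_sequentially] .
  have "(\<lambda>d. 2 * (ln (real d) / real d) + 3 * (ln (1 / L d) / real d)) \<longlonglongrightarrow> 2 * 0 + 3 * 0"
    by (intro tendsto_intros lnd lim)
  hence lim': "(\<lambda>d. (2 * ln (real d) + 3 * ln (1 / L d)) / real d) \<longlonglongrightarrow> 0"
    by (simp add: add_divide_distrib)
  have "(?g \<longlongrightarrow> 0) (inf (filtercomap (\<lambda>(\<epsilon>, d). real d + 1 / \<epsilon>) at_top) (principal ({0<..<1} \<times> {1..})))"
  proof (rule tendstoI)
    fix e :: real assume e: "0 < e"
    define \<eta> where "\<eta> = e / 2"
    have \<eta>: "0 < \<eta>" using e by (simp add: \<eta>_def)
    obtain B where B: "\<And>d. 1 \<le> d \<Longrightarrow> 2 * ln (real d) + 3 * ln (1 / L d) \<le> \<eta> * real d + B"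
      using sublinear_imp_affine_bound[OF lim' \<eta>] by blast
    define B' where "B' = ln 6 + 3 * ln (2 / \<kappa>) + 3 * ln (3 / \<eta>) + \<bar>B\<bar>"
    have small: "dist (?g (\<epsilon>, d)) 0 < e"
      if \<epsilon>: "0 < \<epsilon>" "\<epsilon> < 1" and d: "1 \<le> d" and large: "max 1 (B' / \<eta>) < real d + 1 / \<epsilon>" for \<epsilon> d
    proof -
      \<comment> \<open>\<open>3 * ln (1 / \<epsilon>)\<close> is made smaller than \<open>\<eta> / \<epsilon>\<close> up to a constant by the tangent inequality
        at a rescaled argument.\<close>
      have "ln (\<eta> / 3 * (1 / \<epsilon>)) \<le> \<eta> / 3 * (1 / \<epsilon>) - 1"
        using \<eta> \<epsilon> by (intro ln_le_minus_one) auto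
      hence "3 * ln (1 / \<epsilon>) \<le> \<eta> * (1 / \<epsilon>) + 3 * ln (3 / \<eta>)"
        using \<eta> \<epsilon> by (simp add: ln_mult ln_div)
      hence "ln (real (the_enat (?n \<epsilon> d))) \<le> \<eta> * (real d + 1 / \<epsilon>) + B'"
        using bound(3)[OF d \<epsilon> d d d] B[OF d] unfolding B'_def distrib_left by linarith
      also have "B' < \<eta> * (real d + 1 / \<epsilon>)"
        using large \<eta> by (simp add: pos_divide_less_eq mult.commute)
      also have "\<eta> * (real d + 1 / \<epsilon>) + \<eta> * (real d + 1 / \<epsilon>) = e * (real d + 1 / \<epsilon>)"
        by (simp add: \<eta>_def)
      finally have "ln (real (the_enat (?n \<epsilon> d))) < e * (real d + 1 / \<epsilon>)" by simp
      moreover have "0 < real d + 1 / \<epsilon>" using \<epsilon> by (simp add: add_nonneg_pos)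
      ultimately show ?thesis using bound(2)[OF d \<epsilon> d d d] by (simp add: pos_divide_less_eq)
    qed
    show "\<forall>\<^sub>F x in inf (filtercomap (\<lambda>(\<epsilon>, d). real d + 1 / \<epsilon>) at_top) (principal ({0<..<1} \<times> {1..})).
        dist (?g x) 0 < e"
      unfolding eventually_inf_principal eventually_filtercomap_at_top_dense
    proof (intro exI[of _ "max 1 (B' / \<eta>)"] allI impI)
      fix x :: "real \<times> nat"
      assume "max 1 (B' / \<eta>) < (case x of (\<epsilon>, d) \<Rightarrow> real d + 1 / \<epsilon>)" "x \<in> {0<..<1} \<times> {1..}"
      thus "dist (?g x) 0 < e" using small[of "fst x" "snd x"] by (cases x) auto
    qed
  qed
  with fin show ?thesis unfolding weakly_tractable_def by blast
qed

end

section \<open>The exponential Orlicz norm\<close>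

lemma psi_exp_young: "1 \<le> \<alpha> \<Longrightarrow> young_function (psi_exp \<alpha>) (1 / 2)"
proof
  assume \<alpha>: "1 \<le> \<alpha>"
  show "mono_on {0..} (psi_exp \<alpha>)"
    using \<alpha> by (auto intro!: mono_onI powr_mono2 simp: psi_exp_def)
  have "(1 / 2 :: real) powr \<alpha> \<le> (1 / 2) powr 1"
    using \<alpha> by (intro powr_mono') auto
  hence "exp ((1 / 2 :: real) powr \<alpha>) \<le> exp (1 / 2)" by simp
  also have "\<dots> \<le> 2" by (rule exp_half_le2)
  finally show "psi_exp \<alpha> (1 / 2) \<le> 1" by (simp add: psi_exp_def)
qed auto

lemma le_powr_self:
  fixes x \<alpha> :: real
  assumes "1 \<le> x" "1 \<le> \<alpha>"
  shows "x \<le> x powr \<alpha>"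
  using powr_mono[of 1 \<alpha> x] assms by simp

text \<open>
  Since \<open>\<psi>\<^sub>\<alpha>\<close> grows exponentially, \<open>\<psi>\<^sub>\<alpha>(x) \<le> (2d)\<^sup>d\<close> forces \<open>x\<^sup>\<alpha>\<close>, and with it \<open>x\<close>, to be polynomial
  in \<open>d\<close>: it is at most of order \<open>d log d\<close>, which is estimated by \<open>d\<^sup>2\<close>.
\<close>

lemma psi_exp_initial_discrepancy_ge:
  assumes \<alpha>: "1 \<le> \<alpha>" and d: "1 \<le> d"
  shows "ennreal (1 / 8 * real d powr - 2) \<le> orlicz_norm (psi_exp \<alpha>) d (local_discrepancy d {})"
proof -
  interpret young_function "psi_exp \<alpha>" "1 / 2" using \<alpha> by (rule psi_exp_young)
  have d2: "real d powr - 2 = 1 / (real d)\<^sup>2"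
    using d by (simp add: powr_minus divide_inverse)
  show ?thesis unfolding d2
  proof (rule orlicz_norm_initial_discrepancy_ge[OF d])
    fix x :: real
    assume x: "0 \<le> x" "psi_exp \<alpha> x \<le> (2 * real d) ^ d"
    have "1 \<le> (2 * real d) ^ d" using d by (intro one_le_power) simp
    with x have "exp (x powr \<alpha>) \<le> 2 * (2 * real d) ^ d" by (simp add: psi_exp_def)
    also have "\<dots> \<le> 2 ^ d * (2 * real d) ^ d"
      using d by (intro mult_right_mono self_le_power) auto
    also have "\<dots> = (2 * (2 * real d)) ^ d" by (rule power_mult_distrib[symmetric])
    also have "2 * (2 * real d) = 4 * real d" by simp
    finally have "x powr \<alpha> \<le> ln ((4 * real d) ^ d)" using d by (subst ln_ge_iff) auto
    also have "\<dots> = real d * ln (4 * real d)" by (rule ln_realpow)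
    also have "\<dots> \<le> real d * (4 * real d)"
      using d ln_le_minus_one[of "4 * real d"] by (intro mult_left_mono) auto
    finally have le: "x powr \<alpha> \<le> 4 * (real d)\<^sup>2" by (simp add: power2_eq_square)
    have "x \<le> 4 * (real d)\<^sup>2"
    proof (cases "x \<ge> 1")
      case True
      with le le_powr_self[OF True \<alpha>] show ?thesis by simp
    next
      case False
      moreover have "1 \<le> (real d)\<^sup>2" using d by (intro one_le_power) simp
      ultimately show ?thesis by linarith
    qed
    thus "x \<le> 1 / (2 * (1 / 8 * (1 / (real d)\<^sup>2)))" by simp
  qed (use d in simp)
qed

section \<open>Orlicz norms defined by a growth function\<close>

locale growth_function =
  fixes \<alpha> :: real and \<phi> :: "real \<Rightarrow> real"
  assumes \<alpha>: "1 \<le> \<alpha>"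
    and mono_\<phi>: "mono_on {0..} \<phi>"
    and pos_\<phi>: "\<And>x. 0 \<le> x \<Longrightarrow> 0 < \<phi> x"
    and lim_\<phi>: "filterlim \<phi> at_top at_top"
begin

definition psi_term :: "real \<Rightarrow> nat \<Rightarrow> real" where
  "psi_term x j = (x / \<phi> (real (Suc j) * \<alpha>)) powr (real (Suc j) * \<alpha>)"

lemma exponent_nonneg: "0 \<le> real (Suc j) * \<alpha>"
  using \<alpha> by simp

lemma exponent_ge: "real (Suc j) \<le> real (Suc j) * \<alpha>"
  using \<alpha> mult_left_mono[of 1 \<alpha> "real (Suc j)"] by simp

lemma psi_growth_eq: "0 \<le> x \<Longrightarrow> psi_growth \<alpha> \<phi> x = (\<Sum>j. psi_term x j)"
  unfolding psi_growth_def psi_term_def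
  by (intro suminf_cong) (subst powr_divide; use pos_\<phi>[OF exponent_nonneg] in \<open>simp add: less_imp_le\<close>)

lemma psi_term_nonneg: "0 \<le> psi_term x j"
  by (simp add: psi_term_def)

lemma psi_term_mono:
  assumes "0 \<le> x" "x \<le> y"
  shows "psi_term x j \<le> psi_term y j"
  unfolding psi_term_def using assms pos_\<phi>[OF exponent_nonneg, of j] exponent_nonneg[of j]
  by (intro powr_mono2 divide_right_mono divide_nonneg_nonneg) auto

text \<open>
  The comparison with a geometric series that yields both convergence, since \<open>\<phi>\<close> tends to infinity,
  and \<open>\<psi>(\<kappa>) \<le> 1\<close> for \<open>\<kappa> \<le> \<phi> 0 / 2\<close>, since \<open>\<phi>\<close> is bounded below by \<open>\<phi> 0\<close>.
\<close>

lemma psi_term_le_half_power: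
  assumes "0 \<le> x" "2 * x \<le> \<phi> (real (Suc j) * \<alpha>)"
  shows "psi_term x j \<le> (1 / 2) ^ Suc j"
proof -
  note pos = pos_\<phi>[OF exponent_nonneg, of j]
  have "psi_term x j \<le> (1 / 2) powr (real (Suc j) * \<alpha>)"
    unfolding psi_term_def using assms pos exponent_nonneg[of j]
    by (intro powr_mono2) (auto simp: field_simps)
  also have "\<dots> \<le> (1 / 2) powr real (Suc j)"
    using exponent_ge by (intro powr_mono') auto
  also have "\<dots> = (1 / 2) ^ Suc j" by (rule powr_realpow) simp
  finally show ?thesis .
qed

lemma summable_psi_term:
  assumes "0 \<le> x"
  shows "summable (psi_term x)"
proof (rule summable_comparison_test_ev)
  have "filterlim (\<lambda>j. real (Suc j)) at_top sequentially"
    using filterlim_compose[OF filterlim_real_sequentially filterlim_Suc] .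
  hence "filterlim (\<lambda>j. real (Suc j) * \<alpha>) at_top sequentially"
    by (rule filterlim_at_top_mono) (use exponent_ge in auto)
  hence "filterlim (\<lambda>j. \<phi> (real (Suc j) * \<alpha>)) at_top sequentially"
    by (rule filterlim_compose[OF lim_\<phi>])
  hence "\<forall>\<^sub>F j in sequentially. 2 * x \<le> \<phi> (real (Suc j) * \<alpha>)"
    by (simp add: filterlim_at_top)
  thus "\<forall>\<^sub>F j in sequentially. norm (psi_term x j) \<le> (1 / 2) ^ Suc j"
    by eventually_elim (use psi_term_le_half_power[OF assms] psi_term_nonneg in auto)
  show "summable (\<lambda>j. (1 / 2 :: real) ^ Suc j)"
    using power_half_series by (rule sums_summable)
qed

lemma young_function_psi_growth: "young_function (psi_growth \<alpha> \<phi>) (min 1 (\<phi> 0 / 2))"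
proof
  let ?\<kappa> = "min 1 (\<phi> 0 / 2)"
  show "0 < ?\<kappa>" using pos_\<phi>[of 0] by simp
  show "mono_on {0..} (psi_growth \<alpha> \<phi>)"
    by (auto intro!: mono_onI suminf_le psi_term_mono summable_psi_term simp: psi_growth_eq)
  have le: "psi_term ?\<kappa> j \<le> (1 / 2) ^ Suc j" for j
  proof (rule psi_term_le_half_power)
    have "\<phi> 0 \<le> \<phi> (real (Suc j) * \<alpha>)"
      using exponent_nonneg by (intro mono_onD[OF mono_\<phi>]) auto
    thus "2 * ?\<kappa> \<le> \<phi> (real (Suc j) * \<alpha>)" by (auto simp: min_def)
  qed (use \<open>0 < ?\<kappa>\<close> in simp)
  have "psi_growth \<alpha> \<phi> ?\<kappa> = (\<Sum>j. psi_term ?\<kappa> j)"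
    using \<open>0 < ?\<kappa>\<close> by (intro psi_growth_eq) simp
  also have "\<dots> \<le> (\<Sum>j. (1 / 2) ^ Suc j)"
    using \<open>0 < ?\<kappa>\<close> by (intro suminf_le le summable_psi_term sums_summable[OF power_half_series]) auto
  also have "\<dots> = 1" using power_half_series by (rule sums_unique[symmetric])
  finally show "psi_growth \<alpha> \<phi> ?\<kappa> \<le> 1" .
qed auto

text \<open>
  If \<open>\<psi> x \<le> (2 * d) ^ d\<close>, then in particular the \<open>d\<close>-th term \<open>(x / \<phi> (d * \<alpha>)) powr (d * \<alpha>)\<close> is at
  most \<open>(2 * d) ^ d\<close>; taking the \<open>d\<close>-th root and using \<open>\<alpha> \<ge> 1\<close> gives \<open>x \<le> 2 * d * \<phi> (d * \<alpha>)\<close>.  The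
  maximum with \<open>1\<close> makes the lower bound at most \<open>1\<close>, as the cardinality bounds require.
\<close>

lemma initial_discrepancy_ge:
  assumes d: "1 \<le> d"
  shows "ennreal (1 / (4 * real d * max 1 (\<phi> (real d * \<alpha>))))
    \<le> orlicz_norm (psi_growth \<alpha> \<phi>) d (local_discrepancy d {})"
proof -
  interpret young_function "psi_growth \<alpha> \<phi>" "min 1 (\<phi> 0 / 2)" by (rule young_function_psi_growth)
  let ?p = "real d * \<alpha>" and ?m = "max 1 (\<phi> (real d * \<alpha>))"
  show ?thesis
  proof (rule orlicz_norm_initial_discrepancy_ge[OF d])
    show "0 < 1 / (4 * real d * ?m)" using d by (simp add: less_max_iff_disj)
    fix x :: real
    assume x: "0 \<le> x" "psi_growth \<alpha> \<phi> x \<le> (2 * real d) ^ d"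
    have p: "0 < ?p" using d \<alpha> by simp
    define y where "y = x / \<phi> ?p"
    have y: "0 \<le> y" using x pos_\<phi>[of ?p] p by (simp add: y_def)
    have "(y powr \<alpha>) ^ d = y powr ?p"
    proof (cases "y = 0")
      case False
      thus ?thesis using y by (simp add: powr_powr mult.commute flip: powr_realpow)
    qed (use d in simp)
    also have "y powr ?p = psi_term x (d - 1)"
      using d by (simp add: psi_term_def y_def)
    also have "\<dots> \<le> (\<Sum>j. psi_term x j)"
      using sum_le_suminf[OF summable_psi_term[OF x(1)], of "{d - 1}"] psi_term_nonneg by simp
    also have "\<dots> \<le> (2 * real d) ^ d" using x by (simp add: psi_growth_eq)
    finally have "y powr \<alpha> \<le> 2 * real d" 
      using d power_le_imp_le_base[of "y powr \<alpha>" "d - 1" "2 * real d"] by simp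
    hence "y \<le> 2 * real d"
      using le_powr_self[of y \<alpha>] \<alpha> d by (cases "y \<ge> 1") auto
    hence "x \<le> 2 * real d * \<phi> ?p" using pos_\<phi>[of ?p] p by (simp add: y_def pos_divide_le_eq)
    also have "\<dots> \<le> 2 * real d * ?m" by (intro mult_left_mono) auto
    finally show "x \<le> 1 / (2 * (1 / (4 * real d * ?m)))" by simp
  qed
qed

lemma polynomial_bound_psi_growth:
  assumes r: "0 \<le> r" and C: "0 < C" "\<And>p. 1 \<le> p \<Longrightarrow> \<phi> p \<le> C * p powr r" and \<tau>: "3 + 2 * r < \<tau>"
  shows "\<exists>C>0. \<exists>\<sigma>>0. polynomial_bound (orlicz_norm (psi_growth \<alpha> \<phi>)) C \<tau> \<sigma>"
proof -
  interpret young_function "psi_growth \<alpha> \<phi>" "min 1 (\<phi> 0 / 2)" by (rule young_function_psi_growth)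
  define D where "D = max 1 C * \<alpha> powr r"
  have \<alpha>r: "1 \<le> \<alpha> powr r" using \<alpha> r by (rule ge_one_powr_ge_zero)
  have D: "1 \<le> D" unfolding D_def using \<alpha>r mult_mono[of 1 "max 1 C" 1 "\<alpha> powr r"] by simp
  show ?thesis
  proof (rule polynomial_bound_if_initial_discrepancy_ge[where c = "1 / (4 * D)" and s = "1 + r"])
    fix d :: nat assume d: "1 \<le> d"
    have "real d * 1 \<le> real d * \<alpha>" using \<alpha> by (intro mult_left_mono) auto
    hence p: "1 \<le> real d * \<alpha>" using d by linarith
    have "1 \<le> (real d * \<alpha>) powr r" using p r by (rule ge_one_powr_ge_zero)
    hence "max 1 (\<phi> (real d * \<alpha>)) \<le> max 1 C * (real d * \<alpha>) powr r"
      using C(2)[OF p] mult_mono[of 1 "max 1 C" 1 "(real d * \<alpha>) powr r"]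
        mult_right_mono[of C "max 1 C" "(real d * \<alpha>) powr r"] by simp
    also have "\<dots> = D * real d powr r" using \<alpha> by (simp add: D_def powr_mult)
    finally have "4 * real d * max 1 (\<phi> (real d * \<alpha>)) \<le> 4 * real d * (D * real d powr r)"
      by (intro mult_left_mono) auto
    moreover have "0 < 4 * real d * max 1 (\<phi> (real d * \<alpha>))"
      using d by (simp add: less_max_iff_disj)
    ultimately have "1 / (4 * real d * (D * real d powr r)) \<le> 1 / (4 * real d * max 1 (\<phi> (real d * \<alpha>)))"
      using d D by (intro divide_left_mono mult_pos_pos) auto
    moreover have "real d powr - (1 + r) = inverse (real d * real d powr r)"
      unfolding powr_minus powr_add by simp
    hence "1 / (4 * D) * real d powr - (1 + r) = 1 / (4 * real d * (D * real d powr r))"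
      by (simp only: divide_inverse inverse_mult_distrib mult_1_left mult_ac)
    ultimately show "ennreal (1 / (4 * D) * real d powr - (1 + r))
        \<le> orlicz_norm (psi_growth \<alpha> \<phi>) d (local_discrepancy d {})"
      using initial_discrepancy_ge[OF d] by (metis ennreal_leI order_trans)
  qed (use D r \<tau> in auto)
qed

text \<open>
  The logarithm of the lower bound \<open>1 / (4 * d * max 1 (\<phi> (d * \<alpha>)))\<close> is sublinear in \<open>d\<close>, because
  \<open>ln (\<phi> (d * \<alpha>)) / d\<close> is \<open>\<alpha>\<close> times the given quotient along \<open>p = d * \<alpha>\<close>.
\<close>

lemma weakly_tractable_psi_growth:
  assumes lim: "((\<lambda>p. ln (\<phi> p) / p) \<longlongrightarrow> 0) at_top"
  shows "weakly_tractable (orlicz_norm (psi_growth \<alpha> \<phi>))"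
proof -
  interpret young_function "psi_growth \<alpha> \<phi>" "min 1 (\<phi> 0 / 2)" by (rule young_function_psi_growth)
  let ?m = "\<lambda>d::nat. max 1 (\<phi> (real d * \<alpha>))"
  have m: "1 \<le> ?m d" for d by simp
  have pos: "0 < \<phi> (real d * \<alpha>)" for d using \<alpha> by (intro pos_\<phi>) simp
  show ?thesis
  proof (rule weakly_tractable_if_initial_discrepancy_ge[OF _ _ initial_discrepancy_ge])
    fix d :: nat assume d: "1 \<le> d"
    have "1 * 1 \<le> (4 * real d) * ?m d" using d by (intro mult_mono) auto
    thus "0 < 1 / (4 * real d * ?m d)" "1 / (4 * real d * ?m d) \<le> 1" by auto
  next
    have "filterlim (\<lambda>d. real d * \<alpha>) at_top sequentially"
      using \<alpha> by (intro filterlim_tendsto_pos_mult_at_top[THEN filterlim_mono]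
        filterlim_at_top_mult_tendsto_pos[OF tendsto_const _ filterlim_real_sequentially]) auto
    from filterlim_compose[OF lim this]
    have "(\<lambda>d. max 0 (\<alpha> * (ln (\<phi> (real d * \<alpha>)) / (real d * \<alpha>)))) \<longlonglongrightarrow> max 0 (\<alpha> * 0)"
      by (intro tendsto_intros)
    moreover have "max 0 (\<alpha> * (ln (\<phi> (real d * \<alpha>)) / (real d * \<alpha>))) = ln (?m d) / real d" for d
      using \<alpha> pos[of d] by (auto simp: max_def divide_le_0_iff zero_le_divide_iff)
    ultimately have "(\<lambda>d. ln (?m d) / real d) \<longlonglongrightarrow> 0" by simp
    moreover have "(\<lambda>d. ln (real d) / real d) \<longlonglongrightarrow> 0"
      using filterlim_compose[OF ln_x_over_x_tendsto_0 filterlim_real_sequentially] .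
    moreover have "(\<lambda>d. ln 4 / real d) \<longlonglongrightarrow> 0" by (rule lim_const_over_n)
    ultimately have "(\<lambda>d. ln 4 / real d + ln (real d) / real d + ln (?m d) / real d) \<longlonglongrightarrow> 0 + 0 + 0"
      by (intro tendsto_add)
    moreover have "\<forall>\<^sub>F d in sequentially. ln 4 / real d + ln (real d) / real d + ln (?m d) / real d
        = ln (1 / (1 / (4 * real d * ?m d))) / real d"
      using eventually_gt_at_top[of 0]
    proof eventually_elim
      case (elim d)
      have "ln (4 * real d * ?m d) = ln 4 + ln (real d) + ln (?m d)"
        using elim m[of d] by (simp add: ln_mult less_max_iff_disj)
      thus ?case by (simp add: add_divide_distrib)
    qed
    ultimately show "(\<lambda>d. ln (1 / (1 / (4 * real d * ?m d))) / real d) \<longlonglongrightarrow> 0"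
      by (simp add: tendsto_cong)
  qed
qed

end

section \<open>Tractability of the discrepancy\<close>

lemma d_exponent_le:
  assumes "0 \<le> \<tau>" "\<And>\<tau>'. \<tau> < \<tau>' \<Longrightarrow> \<exists>C>0. \<exists>\<sigma>>0. polynomial_bound nrm C \<tau>' \<sigma>"
  shows "d_exponent nrm \<le> \<tau>"
proof (rule field_le_epsilon)
  fix e :: real assume "0 < e"
  with assms show "d_exponent nrm \<le> \<tau> + e"
    unfolding d_exponent_def by (intro cInf_lower bdd_belowI[of _ 0]) auto
qed

theorem theorem1:
  fixes \<alpha> :: real
  assumes "1 \<le> \<alpha>"
  shows "polynomially_tractable (orlicz_norm (psi_exp \<alpha>)) \<and>
    (\<forall>(\<phi> :: real \<Rightarrow> real) (r :: real).
       mono_on {0..} \<phi> \<and> (\<forall>x\<ge>0. 0 < \<phi> x) \<and> filterlim \<phi> at_top at_top \<and>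
       0 \<le> r \<and> (\<exists>C>0. \<forall>p\<ge>1. \<phi> p \<le> C * p powr r) \<longrightarrow>
         polynomially_tractable (orlicz_norm (psi_growth \<alpha> \<phi>)) \<and>
         d_exponent (orlicz_norm (psi_growth \<alpha> \<phi>)) \<le> 3 + 2 * r) \<and>
    (\<forall>\<phi> :: real \<Rightarrow> real.
       mono_on {0..} \<phi> \<and> (\<forall>x\<ge>0. 0 < \<phi> x) \<and> filterlim \<phi> at_top at_top \<and>
       ((\<lambda>p. ln (\<phi> p) / p) \<longlongrightarrow> 0) at_top \<longrightarrow>
         weakly_tractable (orlicz_norm (psi_growth \<alpha> \<phi>)))"
proof (intro conjI allI impI)
  interpret young_function "psi_exp \<alpha>" "1 / 2" using assms by (rule psi_exp_young)
  have "\<exists>C>0. \<exists>\<sigma>>0. polynomial_bound (orlicz_norm (psi_exp \<alpha>)) C 6 \<sigma>"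
    by (rule polynomial_bound_if_initial_discrepancy_ge[OF _ _ _ psi_exp_initial_discrepancy_ge[OF assms]])
       auto
  thus "polynomially_tractable (orlicz_norm (psi_exp \<alpha>))"
    unfolding polynomially_tractable_def by (meson zero_less_numeral)
next
  fix \<phi> :: "real \<Rightarrow> real" and r :: real
  assume \<phi>: "mono_on {0..} \<phi> \<and> (\<forall>x\<ge>0. 0 < \<phi> x) \<and> filterlim \<phi> at_top at_top \<and>
       0 \<le> r \<and> (\<exists>C>0. \<forall>p\<ge>1. \<phi> p \<le> C * p powr r)"
  then interpret growth_function \<alpha> \<phi> using assms by unfold_locales auto
  from \<phi> obtain C where "0 \<le> r" "0 < C" "\<And>p. 1 \<le> p \<Longrightarrow> \<phi> p \<le> C * p powr r" by blast
  note bound = polynomial_bound_psi_growth[OF this]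
  show "d_exponent (orlicz_norm (psi_growth \<alpha> \<phi>)) \<le> 3 + 2 * r"
    using \<open>0 \<le> r\<close> by (intro d_exponent_le bound) auto
  have "0 < 4 + 2 * r" using \<open>0 \<le> r\<close> by simp
  with bound[of "4 + 2 * r"] show "polynomially_tractable (orlicz_norm (psi_growth \<alpha> \<phi>))"
    unfolding polynomially_tractable_def by auto
next
  fix \<phi> :: "real \<Rightarrow> real"
  assume \<phi>: "mono_on {0..} \<phi> \<and> (\<forall>x\<ge>0. 0 < \<phi> x) \<and> filterlim \<phi> at_top at_top \<and>
       ((\<lambda>p. ln (\<phi> p) / p) \<longlongrightarrow> 0) at_top"
  then interpret growth_function \<alpha> \<phi> using assms by unfold_locales auto
  from \<phi> show "weakly_tractable (orlicz_norm (psi_growth \<alpha> \<phi>))"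
    by (intro weakly_tractable_psi_growth) blast
qed

end
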